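(* Let $\varphi$ be a track function, let $\delta$ be a $\varphi$-diagonal, and let $C$ be a copula satisfying $C(x,\varphi(x))=\delta(x)$ for all $x\in[0,1]$. If $C$ is undominated (among copulas $C'$ with $C'(x,\varphi(x))=\delta(x)$ for all $x$), then there exists an increasing function $\psi:[0,1]\to[0,1]$ with $\psi(0)=0$ such that the functions $$\eta(y)=\delta(\varphi^{-1}(y))-\psi(\varphi^{-1}(y)),\quad \chi(y)=y-\eta(y),\quad \xi(x)=x-\psi(x)$$ are non-negative and increasing on $[0,1]$, and $C=C_\psi$, where $C_\psi(x,y)=(\psi(x)\wedge\chi(y))+(\xi(x)\wedge\eta(y))$.
   Context: "Increasing" means non-decreasing; $a\wedge b=\min\{a,b\}$. A track function is a strictly increasing continuous $\varphi:[0,1]\to[0,1]$ with $\varphi(0)=0$, $\varphi(1)=1$. A $\varphi$-diagonal is an increasing function $\delta:[0,1]\to[0,1]$ with $\delta(1)=1$, $\delta(t)\le\min\{t,\varphi(t)\}$ and $|\delta(t')-\delta(t)|\le|t'-t|+|\varphi(t')-\varphi(t)|$ for all $t,t'\in[0,1]$. A copula $C$ in a family of copulas is undominated if there is no copula $C'\ne C$ in the same family with $C\le C'$ pointwise. A bivariate copula is a function $C:[0,1]^2\to[0,1]$ with $C(x,0)=C(0,x)=0$, $C(x,1)=C(1,x)=x$ and $C(x_2,y_2)-C(x_1,y_2)-C(x_2,y_1)+C(x_1,y_1)\ge0$ whenever $x_1\le x_2$, $y_1\le y_2$. *)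

theory Defs
  imports "HOL-Analysis.Analysis"
begin

text \<open>
  A function on the unit interval (or square) is represented by a total function on the reals
  whose values outside the interval (or square) are irrelevant; hence equality and order of
  functions are always relativised to the domain. ``Increasing'' means non-decreasing.
\<close>

definition track_function :: "(real \<Rightarrow> real) \<Rightarrow> bool" where
  "track_function \<phi> \<longleftrightarrow>
     \<phi> \<in> {0..1} \<rightarrow> {0..1} \<and> strict_mono_on {0..1} \<phi> \<and> continuous_on {0..1} \<phi> \<and>
     \<phi> 0 = 0 \<and> \<phi> 1 = 1"

definition track_diagonal :: "(real \<Rightarrow> real) \<Rightarrow> (real \<Rightarrow> real) \<Rightarrow> bool" where
  "track_diagonal \<phi> \<delta> \<longleftrightarrow>
     \<delta> \<in> {0..1} \<rightarrow> {0..1} \<and> mono_on {0..1} \<delta> \<and> \<delta> 1 = 1 \<and>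
     (\<forall>t\<in>{0..1}. \<delta> t \<le> min t (\<phi> t)) \<and>
     (\<forall>t\<in>{0..1}. \<forall>t'\<in>{0..1}. \<bar>\<delta> t' - \<delta> t\<bar> \<le> \<bar>t' - t\<bar> + \<bar>\<phi> t' - \<phi> t\<bar>)"

definition copula :: "(real \<Rightarrow> real \<Rightarrow> real) \<Rightarrow> bool" where
  "copula C \<longleftrightarrow>
     (\<forall>x\<in>{0..1}. \<forall>y\<in>{0..1}. C x y \<in> {0..1}) \<and>
     (\<forall>x\<in>{0..1}. C x 0 = 0 \<and> C 0 x = 0 \<and> C x 1 = x \<and> C 1 x = x) \<and>
     (\<forall>x1\<in>{0..1}. \<forall>x2\<in>{0..1}. \<forall>y1\<in>{0..1}. \<forall>y2\<in>{0..1}.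
        x1 \<le> x2 \<longrightarrow> y1 \<le> y2 \<longrightarrow> C x2 y2 - C x1 y2 - C x2 y1 + C x1 y1 \<ge> 0)"

definition copulas_with_track_section ::
    "(real \<Rightarrow> real) \<Rightarrow> (real \<Rightarrow> real) \<Rightarrow> (real \<Rightarrow> real \<Rightarrow> real) set" where
  "copulas_with_track_section \<phi> \<delta> = {C. copula C \<and> (\<forall>x\<in>{0..1}. C x (\<phi> x) = \<delta> x)}"

definition undominated_in ::
    "(real \<Rightarrow> real \<Rightarrow> real) set \<Rightarrow> (real \<Rightarrow> real \<Rightarrow> real) \<Rightarrow> bool" where
  "undominated_in F C \<longleftrightarrow> C \<in> F \<and>
     \<not> (\<exists>C'\<in>F. (\<exists>x\<in>{0..1}. \<exists>y\<in>{0..1}. C' x y \<noteq> C x y) \<and>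
                (\<forall>x\<in>{0..1}. \<forall>y\<in>{0..1}. C x y \<le> C' x y))"

definition eta_fun ::
    "(real \<Rightarrow> real) \<Rightarrow> (real \<Rightarrow> real) \<Rightarrow> (real \<Rightarrow> real) \<Rightarrow> real \<Rightarrow> real" where
  "eta_fun \<phi> \<delta> \<psi> y =
     \<delta> (the_inv_into {0..1} \<phi> y) - \<psi> (the_inv_into {0..1} \<phi> y)"

definition chi_fun ::
    "(real \<Rightarrow> real) \<Rightarrow> (real \<Rightarrow> real) \<Rightarrow> (real \<Rightarrow> real) \<Rightarrow> real \<Rightarrow> real" where
  "chi_fun \<phi> \<delta> \<psi> y = y - eta_fun \<phi> \<delta> \<psi> y"

definition xi_fun :: "(real \<Rightarrow> real) \<Rightarrow> real \<Rightarrow> real" where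
  "xi_fun \<psi> x = x - \<psi> x"

definition C_fun ::
    "(real \<Rightarrow> real) \<Rightarrow> (real \<Rightarrow> real) \<Rightarrow> (real \<Rightarrow> real) \<Rightarrow> real \<Rightarrow> real \<Rightarrow> real" where
  "C_fun \<phi> \<delta> \<psi> x y =
     min (\<psi> x) (chi_fun \<phi> \<delta> \<psi> y) + min (xi_fun \<psi> x) (eta_fun \<phi> \<delta> \<psi> y)"

definition nonneg_increasing :: "(real \<Rightarrow> real) \<Rightarrow> bool" where
  "nonneg_increasing f \<longleftrightarrow> (\<forall>t\<in>{0..1}. 0 \<le> f t) \<and> mono_on {0..1} f"

end

(*
  In probabilistic terms, psi(x) is the C-mass of the part {u <= x, v <= phi(u)} of the
  square below the track, and eta(y) the mass of {v <= y, v > phi(u)}.  Splitting C into the parts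
  below and above the track and bounding each by the minimum of its margins gives C <= C_psi;
  as C_psi is itself a copula with the same track section, an undominated C equals C_psi.
  No measure is needed: the argument only uses that psi(t) - psi(s) lies between the masses of the
  rectangles (s,t] x [0,phi(s)] and (s,t] x [0,phi(t)].  Such a psi is the supremum
  of lower Riemann sums.
*)
theory Submission
  imports Defs
begin

section \<open>Additive selections between interval functions\<close>

text \<open>Riemann-type sums of \<open>a\<close> over finite chains in \<open>S\<close> from
  \<open>l\<close> to \<open>t\<close>. Chains grow at the right end, so that an induction only has
  to look at the last link.\<close>

inductive lower_sum :: "'a::linorder set \<Rightarrow> ('a \<Rightarrow> 'a \<Rightarrow> real) \<Rightarrow> 'a \<Rightarrow> 'a \<Rightarrow> real \<Rightarrow> bool"
  for S a l where
  base: "lower_sum S a l l 0"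
| step: "lower_sum S a l s v \<Longrightarrow> t \<in> S \<Longrightarrow> s \<le> t \<Longrightarrow> lower_sum S a l t (v + a s t)"

lemma lower_sum_mem: "lower_sum S a l t v \<Longrightarrow> l \<in> S \<Longrightarrow> l \<le> t \<and> t \<in> S"
  by (induction rule: lower_sum.induct) auto

text \<open>Take \<open>p t\<close> as the supremum of the lower sums up to \<open>t\<close>;
  superadditivity of \<open>b\<close> bounds them by \<open>b l t\<close>. Appending the link from
  \<open>s\<close> to \<open>t\<close> gives the lower estimate. For the upper one, a chain up to
  \<open>t\<close> is cut at \<open>s\<close>, which by subadditivity of \<open>a\<close> does not
  decrease its sum, and the links after \<open>s\<close> add up to at most
  \<open>b s t\<close>.\<close>

lemma additive_between:
  fixes a b :: "'a::linorder \<Rightarrow> 'a \<Rightarrow> real"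
  assumes l: "l \<in> S" "\<And>t. t \<in> S \<Longrightarrow> l \<le> t"
    and le: "\<And>s t. s \<in> S \<Longrightarrow> t \<in> S \<Longrightarrow> s \<le> t \<Longrightarrow> a s t \<le> b s t"
    and a: "\<And>s t u. s \<in> S \<Longrightarrow> t \<in> S \<Longrightarrow> u \<in> S \<Longrightarrow> s \<le> t \<Longrightarrow> t \<le> u \<Longrightarrow> a s u \<le> a s t + a t u"
    and b: "\<And>s t u. s \<in> S \<Longrightarrow> t \<in> S \<Longrightarrow> u \<in> S \<Longrightarrow> s \<le> t \<Longrightarrow> t \<le> u \<Longrightarrow> b s t + b t u \<le> b s u"
  obtains p where "p l = 0"
    and "\<And>s t. s \<in> S \<Longrightarrow> t \<in> S \<Longrightarrow> s \<le> t \<Longrightarrow> a s t \<le> p t - p s"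
    and "\<And>s t. s \<in> S \<Longrightarrow> t \<in> S \<Longrightarrow> s \<le> t \<Longrightarrow> p t - p s \<le> b s t"
proof -
  \<comment> \<open>Coinciding points give \<open>0 \<le> a t t\<close> and
    \<open>b t t \<le> 0\<close>; with \<open>a t t \<le> b t t\<close> both vanish.\<close>
  have diag: "a t t = 0" "b t t = 0" if "t \<in> S" for t
    using a[of t t t] b[of t t t] le[of t t] that by auto
  have bound: "v \<le> b l t" if "lower_sum S a l t v" for t v
    using that
  proof (induction rule: lower_sum.induct)
    case base
    then show ?case using diag l by simp
  next
    case (step s v t)
    moreover have "s \<in> S" using lower_sum_mem step l by blast
    ultimately show ?case using le[of s t] b[of l s t] l by fastforce
  qed
  define p where "p t = Sup {v. lower_sum S a l t v}" for t
  have upper: "v \<le> p t" if "lower_sum S a l t v" for t v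
    unfolding p_def using that bound by (intro cSup_upper) (auto intro!: bdd_aboveI)
  have ex: "\<exists>v. lower_sum S a l t v" if "t \<in> S" for t
    using lower_sum.step[OF lower_sum.base] that l by blast
  have least: "p t \<le> c" if "t \<in> S" "\<And>v. lower_sum S a l t v \<Longrightarrow> v \<le> c" for t c
    unfolding p_def using that ex by (intro cSup_least) auto
  have split: "v \<le> p s + b s t" if "lower_sum S a l t v" "s \<in> S" "s \<le> t" for s t v
    using that
  proof (induction arbitrary: s rule: lower_sum.induct)
    case base
    then have "s = l" using l by (simp add: antisym)
    then show ?case using upper[OF lower_sum.base] diag l by simp
  next
    case (step r v t)
    have r: "r \<in> S" using lower_sum_mem step l by blast
    \<comment> \<open>If \<open>s\<close> precedes the last link, the induction hypothesis cuts the
      shorter chain; otherwise \<open>s\<close> falls inside that link and is inserted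
      there.\<close>
    show ?case
    proof (cases "s \<le> r")
      case True
      have "v \<le> p s + b s r" using step True by blast
      moreover have "a r t \<le> b r t" using le step r by blast
      moreover have "b s r + b r t \<le> b s t" using b step r True by blast
      ultimately show ?thesis by linarith
    next
      case False
      then have rs: "r \<le> s" by simp
      have "v + a r s \<le> p s" using upper lower_sum.step step rs by blast
      moreover have "a s t \<le> b s t" using le step by blast
      moreover have "a r t \<le> a r s + a s t" using a step r rs by blast
      ultimately show ?thesis by linarith
    qed
  qed
  show thesis
  proof
    have "p l \<le> 0" using least[of l 0] bound[of l] diag l by auto
    then show "p l = 0" using upper[OF lower_sum.base] by simp
  next
    fix s t assume st: "s \<in> S" "t \<in> S" "s \<le> t"
    have "p s \<le> p t - a s t"
    proof (rule least[OF st(1)])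
      fix v assume "lower_sum S a l s v"
      then show "v \<le> p t - a s t" using upper lower_sum.step st by (smt (verit))
    qed
    then show "a s t \<le> p t - p s" by simp
    show "p t - p s \<le> b s t" using least[OF st(2) split] st by (simp add: algebra_simps)
  qed
qed

section \<open>Copulas\<close>

lemma copula_rect:
  assumes "copula C" "x1 \<in> {0..1}" "x2 \<in> {0..1}" "y1 \<in> {0..1}" "y2 \<in> {0..1}" "x1 \<le> x2" "y1 \<le> y2"
  shows "C x1 y2 + C x2 y1 \<le> C x2 y2 + C x1 y1"
proof -
  have "C x2 y2 - C x1 y2 - C x2 y1 + C x1 y1 \<ge> 0"
    using assms unfolding copula_def by blast
  then show ?thesis by simp
qed

lemma copula_margins:
  assumes "copula C" "x \<in> {0..1}"
  shows "C x 0 = 0" "C 0 x = 0" "C x 1 = x" "C 1 x = x"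
  using assms unfolding copula_def by auto

text \<open>Rectangles resting on an edge of the square: the height range [0,y] gives monotonicity,
  [y,1] the Lipschitz bound.\<close>

lemma copula_fst:
  assumes "copula C" "x1 \<in> {0..1}" "x2 \<in> {0..1}" "y \<in> {0..1}" "x1 \<le> x2"
  shows "C x1 y \<le> C x2 y" "C x2 y - C x1 y \<le> x2 - x1"
  using copula_rect[of C x1 x2 0 y] copula_rect[of C x1 x2 y 1] assms copula_margins[of C]
  by auto

lemma copula_snd:
  assumes "copula C" "x \<in> {0..1}" "y1 \<in> {0..1}" "y2 \<in> {0..1}" "y1 \<le> y2"
  shows "C x y1 \<le> C x y2" "C x y2 - C x y1 \<le> y2 - y1"
  using copula_rect[of C 0 x y1 y2] copula_rect[of C x 1 y1 y2] assms copula_margins[of C]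
  by auto

lemma copula_le:
  assumes "copula C" "x \<in> {0..1}" "y \<in> {0..1}"
  shows "C x y \<le> x" "C x y \<le> y"
  using copula_fst(1)[of C x 1 y] copula_snd(1)[of C x y 1] assms copula_margins[of C] by auto

text \<open>The right side exceeds the left by the length of the intersection of [f1,f2] and
  [g1,g2].\<close>

lemma min_2increasing:
  fixes f1 f2 g1 g2 :: real
  assumes "f1 \<le> f2" "g1 \<le> g2"
  shows "min f1 g2 + min f2 g1 \<le> min f2 g2 + min f1 g1"
  using assms by (auto simp: min_def)

text \<open>Each minimum couples two margins comonotonically. Equal total masses,
  \<open>f 1 = g 1\<close> and hence \<open>f' 1 = g' 1\<close>, make each minimum reduce to its own
  margin on the far edges, and the margins add up to the identity.\<close>

lemma copula_sum_of_mins: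
  assumes fg: "nonneg_increasing f" "nonneg_increasing f'" "nonneg_increasing g" "nonneg_increasing g'"
    and f: "\<And>x. x \<in> {0..1} \<Longrightarrow> f x + f' x = x" and g: "\<And>y. y \<in> {0..1} \<Longrightarrow> g y + g' y = y"
    and one: "f 1 = g 1"
  shows "copula (\<lambda>x y. min (f x) (g y) + min (f' x) (g' y))"
proof -
  have nonneg: "0 \<le> h t" if "nonneg_increasing h" "t \<in> {0..1}" for h t
    using that unfolding nonneg_increasing_def by blast
  have mono: "h s \<le> h t" if "nonneg_increasing h" "s \<in> {0..1}" "t \<in> {0..1}" "s \<le> t" for h s t
    using that unfolding nonneg_increasing_def mono_on_def by blast
  have zero: "f 0 = 0" "f' 0 = 0" "g 0 = 0" "g' 0 = 0"
    using f[of 0] g[of 0] nonneg[of _ 0] fg by (auto simp: add_nonneg_eq_0_iff)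
  have one': "f' 1 = g' 1" using f[of 1] g[of 1] one by simp
  let ?D = "\<lambda>x y. min (f x) (g y) + min (f' x) (g' y)"
  show ?thesis
    unfolding copula_def
  proof (intro conjI ballI impI)
    fix x y :: real assume xy: "x \<in> {0..1}" "y \<in> {0..1}"
    have "?D x y \<le> f x + f' x" by (intro add_mono) auto
    then have "?D x y \<le> 1" using f[OF xy(1)] xy by auto
    then show "?D x y \<in> {0..1}" using nonneg fg xy by (auto intro!: add_nonneg_nonneg)
  next
    fix x :: real assume x: "x \<in> {0..1}"
    then have "x \<le> 1" "1 \<in> {0..1::real}" by auto
    note m = mono[OF fg(1) x this(2,1)] mono[OF fg(2) x this(2,1)]
      mono[OF fg(3) x this(2,1)] mono[OF fg(4) x this(2,1)]
    show "?D x 0 = 0" "?D 0 x = 0"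
      using x nonneg fg zero by (auto simp: min_absorb1 min_absorb2)
    show "?D x 1 = x" using m f[OF x] one one' by simp
    show "?D 1 x = x" using m g[OF x] one one' by simp
  next
    fix x1 x2 y1 y2 :: real
    assume xy: "x1 \<in> {0..1}" "x2 \<in> {0..1}" "y1 \<in> {0..1}" "y2 \<in> {0..1}" "x1 \<le> x2" "y1 \<le> y2"
    show "0 \<le> ?D x2 y2 - ?D x1 y2 - ?D x2 y1 + ?D x1 y1"
      using min_2increasing[OF mono[OF fg(1) xy(1,2,5)] mono[OF fg(3) xy(3,4,6)]]
        min_2increasing[OF mono[OF fg(2) xy(1,2,5)] mono[OF fg(4) xy(3,4,6)]]
      by linarith
  qed
qed

section \<open>Domination by a copula of the form \<open>C_fun\<close>\<close>

text \<open>The intermediate value theorem makes \<open>\<phi>\<close> onto, hence a bijection of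
  the unit interval, and strict monotonicity passes to the inverse.\<close>

lemma track_function_inverse:
  assumes "track_function \<phi>"
  shows "y \<in> {0..1} \<Longrightarrow> the_inv_into {0..1} \<phi> y \<in> {0..1}"
    and "y \<in> {0..1} \<Longrightarrow> \<phi> (the_inv_into {0..1} \<phi> y) = y"
    and "x \<in> {0..1} \<Longrightarrow> the_inv_into {0..1} \<phi> (\<phi> x) = x"
    and "y \<in> {0..1} \<Longrightarrow> y' \<in> {0..1} \<Longrightarrow> y \<le> y' \<Longrightarrow>
      the_inv_into {0..1} \<phi> y \<le> the_inv_into {0..1} \<phi> y'"
proof -
  have \<phi>: "\<phi> \<in> {0..1} \<rightarrow> {0..1}" "strict_mono_on {0..1} \<phi>" "continuous_on {0..1} \<phi>" "\<phi> 0 = 0" "\<phi> 1 = 1"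
    using assms unfolding track_function_def by auto
  have inj: "inj_on \<phi> {0..1}" using \<phi>(2) strict_mono_on_imp_inj_on by blast
  have "\<exists>x\<in>{0..1}. \<phi> x = y" if "y \<in> {0..1}" for y
    using IVT'[of \<phi> 0 y 1] \<phi> that by auto
  then have "\<phi> ` {0..1} = {0..1}" using \<phi>(1) by fast
  then have bij: "bij_betw \<phi> {0..1} {0..1}" using inj by (simp add: bij_betw_def)
  show 1: "the_inv_into {0..1} \<phi> y \<in> {0..1}" if "y \<in> {0..1}" for y
    using bij_betw_the_inv_into[OF bij] that by (auto simp: bij_betw_def)
  show 2: "\<phi> (the_inv_into {0..1} \<phi> y) = y" if "y \<in> {0..1}" for y
    using f_the_inv_into_f_bij_betw[OF bij] that by blast
  show "the_inv_into {0..1} \<phi> (\<phi> x) = x" if "x \<in> {0..1}"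
    using the_inv_into_f_f[OF inj] that by blast
  show "the_inv_into {0..1} \<phi> y \<le> the_inv_into {0..1} \<phi> y'"
    if "y \<in> {0..1}" "y' \<in> {0..1}" "y \<le> y'"
    using 1[OF that(1)] 1[OF that(2)] 2[OF that(1)] 2[OF that(2)] that(3)
      strict_mono_on_less[OF \<phi>(2)] by (metis not_le)
qed

text \<open>This supplies the competitor for an undominated copula. The lower bounds on the
  increments of \<open>\<psi>\<close> yield domination below the track, the upper bounds above
  it.\<close>

lemma C_fun_dominates:
  assumes \<phi>: "track_function \<phi>" and C: "copula C"
    and \<delta>: "\<And>x. x \<in> {0..1} \<Longrightarrow> C x (\<phi> x) = \<delta> x"
  obtains \<psi> where "\<psi> \<in> {0..1} \<rightarrow> {0..1}" "mono_on {0..1} \<psi>" "\<psi> 0 = 0"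
    "nonneg_increasing (eta_fun \<phi> \<delta> \<psi>)" "nonneg_increasing (chi_fun \<phi> \<delta> \<psi>)"
    "nonneg_increasing (xi_fun \<psi>)"
    "C_fun \<phi> \<delta> \<psi> \<in> copulas_with_track_section \<phi> \<delta>"
    "\<And>x y. x \<in> {0..1} \<Longrightarrow> y \<in> {0..1} \<Longrightarrow> C x y \<le> C_fun \<phi> \<delta> \<psi> x y"
proof -
  note inv = track_function_inverse[OF \<phi>]
  define I where "I = {0..1::real}"
  have \<phi>I: "\<phi> x \<in> I" if "x \<in> I" for x
    using \<phi> that unfolding I_def track_function_def by auto
  have \<phi>01: "\<phi> 0 = 0" "\<phi> 1 = 1" using \<phi> unfolding track_function_def by auto
  have \<phi>mono: "\<phi> s \<le> \<phi> t" if "s \<in> I" "t \<in> I" "s \<le> t" for s t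
    using \<phi> that strict_mono_on_leD unfolding I_def track_function_def by blast
  have I01: "0 \<in> I" "1 \<in> I" "\<And>t. t \<in> I \<Longrightarrow> 0 \<le> t \<and> t \<le> 1" by (auto simp: I_def)
  note rect = copula_rect[OF C, folded I_def]
  note fst = copula_fst[OF C, folded I_def]
  note snd = copula_snd[OF C, folded I_def]
  note margins = copula_margins[OF C, folded I_def]
  note C_le = copula_le[OF C, folded I_def]
  note \<delta> = \<delta>[folded I_def]
  obtain \<psi> where \<psi>0: "\<psi> 0 = 0"
    and low: "\<And>s t. s \<in> I \<Longrightarrow> t \<in> I \<Longrightarrow> s \<le> t \<Longrightarrow> C t (\<phi> s) - C s (\<phi> s) \<le> \<psi> t - \<psi> s"
    and up: "\<And>s t. s \<in> I \<Longrightarrow> t \<in> I \<Longrightarrow> s \<le> t \<Longrightarrow> \<psi> t - \<psi> s \<le> C t (\<phi> t) - C s (\<phi> t)"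
  \<comment> \<open>The bounds are the masses of (s,t] x [0,\<open>\<phi> s\<close>] and (s,t] x
    [0,\<open>\<phi> t\<close>]. Cut (s,u] at \<open>t\<close>: raising the right piece to height
    \<open>\<phi> t\<close> gives subadditivity, lowering the left piece to that height gives
    superadditivity.\<close>
  proof (rule additive_between[of 0 I "\<lambda>s t. C t (\<phi> s) - C s (\<phi> s)" "\<lambda>s t. C t (\<phi> t) - C s (\<phi> t)"])
    fix s t assume st: "s \<in> I" "t \<in> I" "s \<le> t"
    show "C t (\<phi> s) - C s (\<phi> s) \<le> C t (\<phi> t) - C s (\<phi> t)"
      using rect[OF st(1,2) \<phi>I[OF st(1)] \<phi>I[OF st(2)] st(3) \<phi>mono[OF st]] by linarith
  next
    fix s t u assume stu: "s \<in> I" "t \<in> I" "u \<in> I" "s \<le> t" "t \<le> u"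
    show "C u (\<phi> s) - C s (\<phi> s) \<le> C t (\<phi> s) - C s (\<phi> s) + (C u (\<phi> t) - C t (\<phi> t))"
      and "C t (\<phi> t) - C s (\<phi> t) + (C u (\<phi> u) - C t (\<phi> u)) \<le> C u (\<phi> u) - C s (\<phi> u)"
      using rect[OF stu(2,3) \<phi>I[OF stu(1)] \<phi>I[OF stu(2)] stu(5) \<phi>mono[OF stu(1,2,4)]]
        rect[OF stu(1,2) \<phi>I[OF stu(2)] \<phi>I[OF stu(3)] stu(4) \<phi>mono[OF stu(2,3,5)]]
      by linarith+
  qed (use I01 in auto)
  \<comment> \<open>The increment of \<open>\<delta> - \<psi>\<close> lies between the increments of
    \<open>C s\<close> and \<open>C t\<close> over [\<open>\<phi> s\<close>,
    \<open>\<phi> t\<close>], hence between 0 and \<open>\<phi> t - \<phi> s\<close>.\<close>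
  have \<psi>mono: "\<psi> s \<le> \<psi> t" and \<xi>mono: "s - \<psi> s \<le> t - \<psi> t"
    and \<eta>mono: "\<delta> s - \<psi> s \<le> \<delta> t - \<psi> t"
    and \<chi>mono: "\<phi> s - (\<delta> s - \<psi> s) \<le> \<phi> t - (\<delta> t - \<psi> t)"
    if st: "s \<in> I" "t \<in> I" "s \<le> t" for s t
    using low[OF st] up[OF st] \<delta>[OF st(1)] \<delta>[OF st(2)]
      fst[OF st(1,2) \<phi>I[OF st(1)] st(3)] fst[OF st(1,2) \<phi>I[OF st(2)] st(3)]
      snd[OF st(1) \<phi>I[OF st(1)] \<phi>I[OF st(2)] \<phi>mono[OF st]]
      snd[OF st(2) \<phi>I[OF st(1)] \<phi>I[OF st(2)] \<phi>mono[OF st]]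
    by linarith+
  have \<delta>0: "\<delta> 0 = 0" using \<delta>[of 0] margins I01 \<phi>01 by simp
  have \<delta>1: "\<delta> 1 = 1" using \<delta>[of 1] margins I01 \<phi>01 by simp
  have \<delta>_le: "\<delta> x \<le> x" "\<delta> x \<le> \<phi> x" if "x \<in> I" for x
    using C_le[of x "\<phi> x"] \<delta> \<phi>I that by simp_all
  have nonneg: "0 \<le> \<psi> t" "0 \<le> t - \<psi> t" "0 \<le> \<delta> t - \<psi> t" "0 \<le> \<phi> t - (\<delta> t - \<psi> t)" if "t \<in> I" for t
    using \<psi>mono[of 0 t] \<xi>mono[of 0 t] \<eta>mono[of 0 t] \<chi>mono[of 0 t] that I01 \<psi>0 \<delta>0 \<phi>01 by auto
  have \<eta>_eq: "eta_fun \<phi> \<delta> \<psi> (\<phi> s) = \<delta> s - \<psi> s" if "s \<in> I" for s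
    using that inv(3) by (simp add: eta_fun_def I_def)
  have \<chi>_eq: "chi_fun \<phi> \<delta> \<psi> (\<phi> s) = \<phi> s - (\<delta> s - \<psi> s)" if "s \<in> I" for s
    using that \<eta>_eq by (simp add: chi_fun_def)
  \<comment> \<open>Every height is parametrized by its track point, so claims about
    \<open>eta_fun\<close> and \<open>chi_fun\<close> reduce to the inequalities in \<open>s\<close>
    shown above.\<close>
  have track: "\<exists>s s'. s \<in> I \<and> s' \<in> I \<and> s \<le> s' \<and> y = \<phi> s \<and> y' = \<phi> s'"
    if "y \<in> I" "y' \<in> I" "y \<le> y'" for y y'
    using inv(1,2)[of y] inv(1,2)[of y'] inv(4)[of y y'] that unfolding I_def by metis
  have incr: "nonneg_increasing h"
    if "\<And>s. s \<in> I \<Longrightarrow> 0 \<le> h (\<phi> s)" "\<And>s t. s \<in> I \<Longrightarrow> t \<in> I \<Longrightarrow> s \<le> t \<Longrightarrow> h (\<phi> s) \<le> h (\<phi> t)" for h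
    unfolding nonneg_increasing_def mono_on_def I_def[symmetric]
    using track that by (metis order_refl)
  have \<eta>: "nonneg_increasing (eta_fun \<phi> \<delta> \<psi>)" and \<chi>: "nonneg_increasing (chi_fun \<phi> \<delta> \<psi>)"
    using nonneg \<eta>mono \<chi>mono by (auto intro!: incr simp only: \<eta>_eq \<chi>_eq)
  have \<xi>: "nonneg_increasing (xi_fun \<psi>)" and \<psi>: "nonneg_increasing \<psi>"
    unfolding nonneg_increasing_def I_def[symmetric] mono_on_def
    using nonneg \<xi>mono \<psi>mono by (auto simp: xi_fun_def)
  have "copula (C_fun \<phi> \<delta> \<psi>)"
    unfolding C_fun_def
  proof (rule copula_sum_of_mins[OF \<psi> \<xi> \<chi> \<eta>])
    show "\<psi> 1 = chi_fun \<phi> \<delta> \<psi> 1" using \<chi>_eq[of 1] \<phi>01 \<delta>1 I01 by simp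
  qed (auto simp: xi_fun_def chi_fun_def)
  \<comment> \<open>The second minimum is \<open>\<delta> s - \<psi> s\<close>, because \<open>x -
    \<psi> x \<ge> \<delta> x - \<psi> x \<ge> \<delta> s - \<psi> s\<close>. For
    \<open>x = s\<close> the formula gives the track section.\<close>
  moreover have below: "C_fun \<phi> \<delta> \<psi> x (\<phi> s) = min (\<delta> s + (\<psi> x - \<psi> s)) (\<phi> s)"
    if "s \<in> I" "x \<in> I" "s \<le> x" for s x
    using \<eta>mono[OF that] \<delta>_le[of x] that \<eta>_eq \<chi>_eq
    by (auto simp: C_fun_def xi_fun_def min_def)
  ultimately have mem: "C_fun \<phi> \<delta> \<psi> \<in> copulas_with_track_section \<phi> \<delta>"
    unfolding copulas_with_track_section_def I_def[symmetric] using \<delta>_le by simp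
  \<comment> \<open>Here the first minimum is \<open>\<psi> x\<close>: the value of
    \<open>chi_fun\<close> at \<open>\<phi> s\<close> is at least that at \<open>\<phi> x\<close>,
    which is \<open>\<psi> x + (\<phi> x - \<delta> x)\<close>.\<close>
  have above: "C_fun \<phi> \<delta> \<psi> x (\<phi> s) = min x (\<delta> s - (\<psi> s - \<psi> x))"
    if "s \<in> I" "x \<in> I" "x \<le> s" for s x
    using \<chi>mono[OF that(2,1,3)] \<delta>_le[of x] that \<eta>_eq \<chi>_eq
    by (auto simp: C_fun_def xi_fun_def min_def)
  have dom: "C x y \<le> C_fun \<phi> \<delta> \<psi> x y" if xy: "x \<in> I" "y \<in> I" for x y
  proof -
    obtain s where s: "s \<in> I" "y = \<phi> s" using track xy by blast
    \<comment> \<open>One argument of the minimum bounds \<open>C x y\<close> by a margin; the other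
      does so by comparing \<open>C x y\<close> with the value \<open>\<delta> s\<close> on the
      track at the same height.\<close>
    show ?thesis
    proof (cases "s \<le> x")
      case True
      then show ?thesis using below[of s x] low[of s x] C_le[of x y] \<delta>[of s] s xy by simp
    next
      case False
      then show ?thesis using above[of s x] up[of x s] C_le[of x y] \<delta>[of s] s xy by simp
    qed
  qed
  show thesis
  proof (rule that)
    have "\<psi> t \<le> 1" if "t \<in> I" for t using nonneg(2)[OF that] I01(3)[OF that] by linarith
    then show "\<psi> \<in> {0..1} \<rightarrow> {0..1}" using nonneg by (auto simp: I_def)
    show "mono_on {0..1} \<psi>" using \<psi> by (simp add: nonneg_increasing_def)
  qed (use \<psi>0 \<eta> \<chi> \<xi> mem dom in \<open>simp_all add: I_def\<close>)
qed

theorem corollary3p5: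
  fixes \<phi> \<delta> :: "real \<Rightarrow> real" and C :: "real \<Rightarrow> real \<Rightarrow> real"
  assumes "track_function \<phi>"
    and "track_diagonal \<phi> \<delta>"
    and "copula C"
    and "\<forall>x\<in>{0..1}. C x (\<phi> x) = \<delta> x"
    and "undominated_in (copulas_with_track_section \<phi> \<delta>) C"
  shows "\<exists>\<psi> :: real \<Rightarrow> real.
           \<psi> \<in> {0..1} \<rightarrow> {0..1} \<and> mono_on {0..1} \<psi> \<and> \<psi> 0 = 0 \<and>
           nonneg_increasing (eta_fun \<phi> \<delta> \<psi>) \<and>
           nonneg_increasing (chi_fun \<phi> \<delta> \<psi>) \<and>
           nonneg_increasing (xi_fun \<psi>) \<and>
           (\<forall>x\<in>{0..1}. \<forall>y\<in>{0..1}. C x y = C_fun \<phi> \<delta> \<psi> x y)"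
proof -
  obtain \<psi> where "\<psi> \<in> {0..1} \<rightarrow> {0..1}" "mono_on {0..1} \<psi>" "\<psi> 0 = 0"
    "nonneg_increasing (eta_fun \<phi> \<delta> \<psi>)" "nonneg_increasing (chi_fun \<phi> \<delta> \<psi>)"
    "nonneg_increasing (xi_fun \<psi>)"
    and mem: "C_fun \<phi> \<delta> \<psi> \<in> copulas_with_track_section \<phi> \<delta>"
    and dom: "\<And>x y. x \<in> {0..1} \<Longrightarrow> y \<in> {0..1} \<Longrightarrow> C x y \<le> C_fun \<phi> \<delta> \<psi> x y"
    using C_fun_dominates[OF assms(1,3)] assms(4) by blast
  \<comment> \<open>Any point of difference would make \<open>C_fun \<phi> \<delta> \<psi>\<close> a
    dominating member of the family other than \<open>C\<close>.\<close>
  moreover have "\<forall>x\<in>{0..1}. \<forall>y\<in>{0..1}. C x y = C_fun \<phi> \<delta> \<psi> x y"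
    using assms(5) mem dom unfolding undominated_in_def by metis
  ultimately show ?thesis by blast
qed

end
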